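(* Let $s\in\mathbb{C}$. For every $\omega\in\mathbb{C}'=\mathbb{C}\setminus\mathbb{R}_{\le 0}$, $$G_{s}(\omega)=G_{s}(\omega+1)+(\omega+1)^{-s}\,G_{s}\!\left(\frac{\omega}{\omega+1}\right).$$
   Context: For $s\in\mathbb{C}$ and $\omega\in\mathbb{C}'=\mathbb{C}\setminus\mathbb{R}_{\le0}$, $$G_{s}(\omega)=\int_{C}\frac{(-t)^{s-1}}{(e^{2\pi i t}-1)(e^{-2\pi i\omega t}-1)}\,dt,$$ where $(-t)^{s-1}=e^{(s-1)\mathrm{Log}(-t)}$ is the principal value and the contour $C$ is a rotation about $t=0$ of an upward-oriented line $-\epsilon+i\mathbb{R}$ that separates the poles at $\mathbb{Z}_{\ge0}\cup\omega^{-1}\mathbb{Z}_{\ge0}$ from those at $\mathbb{Z}_{\le-1}\cup\omega^{-1}\mathbb{Z}_{\le-1}$. Explicitly: $C=\{e^{i\eta}(-\epsilon+iy)\mid y\in\mathbb{R}\}$ oriented by increasing $y$, where $\eta\in(-\pi/2,\pi/2)$ satisfies $\mathrm{Re}(e^{-i\eta}\omega^{-1})>0$ and $0<\epsilon<\min\{\cos\eta,\mathrm{Re}(e^{-i\eta}\omega^{-1})\}$; for $\omega>0$ one may take $\eta=0$, $0<\epsilon<\min\{1,1/\omega\}$. The integral does not depend on these choices and $G_{s}$ is holomorphic on $\mathbb{C}'$. Powers $(\omega+1)^{-s}$ are principal values. *)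

theory Defs
  imports "HOL-Complex_Analysis.Complex_Analysis"
begin

definition admissible :: "complex \<Rightarrow> real \<Rightarrow> real \<Rightarrow> bool" where
  "admissible \<omega> \<eta> \<epsilon> \<longleftrightarrow>
     \<eta> \<in> {-pi/2 <..< pi/2} \<and> Re (cis (-\<eta>) * inverse \<omega>) > 0 \<and>
     0 < \<epsilon> \<and> \<epsilon> < min (cos \<eta>) (Re (cis (-\<eta>) * inverse \<omega>))"

definition contour :: "real \<Rightarrow> real \<Rightarrow> real \<Rightarrow> complex" where
  "contour \<eta> \<epsilon> y = cis \<eta> * (- of_real \<epsilon> + \<i> * of_real y)"

definition G_integrand :: "complex \<Rightarrow> complex \<Rightarrow> complex \<Rightarrow> complex" where
  "G_integrand s \<omega> t =
     (- t) powr (s - 1) /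
       ((exp (2 * of_real pi * \<i> * t) - 1) * (exp (- 2 * of_real pi * \<i> * \<omega> * t) - 1))"

text \<open>
  The library's contour integrals are restricted to paths on \<open>[0,1]\<close>, so the integral along the
  infinite contour is the Lebesgue integral of the pulled-back integrand, \<open>\<i> * cis \<eta>\<close> being the
  derivative of \<open>contour \<eta> \<epsilon>\<close>.  The value is the common one of all admissible choices of the
  contour: it is pinned down only once absolute convergence and independence of these choices
  are established, and unspecified when \<open>\<omega>\<close> lies in \<open>\<real>\<^sub>\<le>\<^sub>0\<close>, where no choice is admissible.
\<close>
definition G :: "complex \<Rightarrow> complex \<Rightarrow> complex" where
  "G s \<omega> = (THE I. \<forall>\<eta> \<epsilon>. admissible \<omega> \<eta> \<epsilon> \<longrightarrow>
     has_bochner_integral lborel (\<lambda>y. G_integrand s \<omega> (contour \<eta> \<epsilon> y) * (\<i> * cis \<eta>)) I)"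

end

(* With x = exp (2 pi i t) and z = exp (- 2 pi i w t), the partial fraction identity
     1 / ((x - 1) (z - 1)) = 1 / ((x - 1) (z / x - 1)) + 1 / ((x / z - 1) (z - 1))
   splits the integrand of G s w; the substitution t -> (w + 1) t turns the last summand into the
   integrand of G s (w / (w + 1)), up to the factor (w + 1) powr (- s).  A line whose direction is
   that of the square root of w serves all three integrals at once.

   The values do not depend on the lines: the derivative in c of the integrand along the line
   Re (c t) = - 1 is a total derivative in the parameter y of the line, so the integral truncated to
   [- R, R] varies by boundary terms only, and these vanish as R tends to infinity because the
   integrand decays exponentially, uniformly on segments of directions c. *)

theory Submission
  imports Defs "HOL-Probability.Sinc_Integral" "HOL-Real_Asymp.Real_Asymp"
begin

section \<open>Lines of integration and the domain of the integrand\<close>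

text \<open>
  A line \<open>contour \<eta> \<epsilon>\<close> is described by the single complex number \<open>c = cis (- \<eta>) / \<epsilon>\<close>: it is the set
  of all \<open>t\<close> with \<open>Re (c t) = - 1\<close>, parametrised by \<open>t = (- 1 + \<i> y) / c\<close>.  Admissibility becomes
  the following condition, which is convex in \<open>c\<close>.
\<close>
definition direction :: "complex \<Rightarrow> complex \<Rightarrow> bool" where
  "direction \<omega> c \<longleftrightarrow> Re c > 1 \<and> Re (c / \<omega>) > 1"

text \<open>The factor \<open>\<i> / c\<close> is the derivative of the parametrisation
  \<open>Complex (-1) y / c\<close> with respect to \<open>y\<close>.\<close>

definition line_integrand :: "complex \<Rightarrow> complex \<Rightarrow> complex \<Rightarrow> real \<Rightarrow> complex" where
  "line_integrand s \<omega> c y = G_integrand s \<omega> (Complex (-1) y / c) * (\<i> / c)"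

definition regular_set :: "complex \<Rightarrow> complex set" where
  "regular_set \<omega> = {t. - t \<notin> \<real>\<^sub>\<le>\<^sub>0 \<and> exp (2 * of_real pi * \<i> * t) \<noteq> 1 \<and>
     exp (- 2 * of_real pi * \<i> * \<omega> * t) \<noteq> 1}"

lemma direction_nonzero:
  assumes "direction \<omega> c"
  shows "c \<noteq> 0" "\<omega> \<noteq> 0"
  using assms by (auto simp: direction_def)

lemma exp_2pi_i_eq_1_imp_int:
  assumes "exp (2 * of_real pi * \<i> * t) = 1"
  obtains n :: int where "t = of_int n"
proof -
  from assms obtain n :: int where "Im t = 0" "Re t = of_int n"
    by (auto simp: exp_eq_1)
  then have "t = of_int n" by (simp add: complex_eq_iff)
  then show ?thesis by (rule that)
qed

text \<open>An integer \<open>n\<close> on the line would satisfy \<open>-1 = n * Re c\<close>, but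
  the right side is nonnegative for \<open>n \<ge> 0\<close> and below \<open>-1\<close> for
  \<open>n \<le> -1\<close>. Thus \<open>Re c > 1\<close> makes the line pass between the poles at
  \<open>-1\<close> and \<open>0\<close>.\<close>

lemma exp_line_neq_1:
  assumes "Re c > 1"
  shows "exp (2 * of_real pi * \<i> * (Complex (-1) y / c)) \<noteq> 1"
proof
  assume "exp (2 * of_real pi * \<i> * (Complex (-1) y / c)) = 1"
  then obtain n :: int where "Complex (-1) y / c = of_int n"
    by (rule exp_2pi_i_eq_1_imp_int)
  moreover have "c \<noteq> 0" using assms by auto
  ultimately have "Complex (-1) y = of_int n * c"
    by (simp add: field_simps)
  then have *: "-1 = of_int n * Re c"
    by (simp add: complex_eq_iff)
  show False
  proof (cases "n \<ge> 0")
    case True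
    then have "of_int n * Re c \<ge> 0" using assms by simp
    then show False using * by simp
  next
    case False
    then have "of_int n \<le> (-1 :: real)" by linarith
    then have "of_int n * Re c \<le> -1 * Re c" using assms by (intro mult_right_mono) auto
    then show False using * assms by linarith
  qed
qed

text \<open>The second exponential has the shape of the first, with \<open>c / \<omega>\<close> in
  place of \<open>c\<close> and the sign reversed, so facts on the first factor carry over to the
  second.\<close>

lemma second_exponent_line:
  assumes "\<omega> \<noteq> 0"
  shows "- 2 * of_real pi * \<i> * \<omega> * (w / c) = 2 * of_real pi * \<i> * (- (w / (c / \<omega>)))"
  using assms by simp

lemma line_in_regular_set:
  assumes "direction \<omega> c"
  shows "Complex (-1) y / c \<in> regular_set \<omega>"
proof -
  note nz = direction_nonzero[OF assms]
  have "- (Complex (-1) y / c) \<notin> \<real>\<^sub>\<le>\<^sub>0"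
  proof
    assume "- (Complex (-1) y / c) \<in> \<real>\<^sub>\<le>\<^sub>0"
    then obtain r where r: "- (Complex (-1) y / c) = complex_of_real r" "r \<le> 0"
      by (rule nonpos_Reals_cases)
    then have "Complex (-1) y = - complex_of_real r * c"
      using nz by (metis divide_minus_left minus_minus mult_minus_left nonzero_divide_eq_eq)
    then have "-1 = - r * Re c"
      by (simp add: complex_eq_iff)
    moreover have "r * Re c \<le> 0"
      using r assms by (auto simp: direction_def mult_le_0_iff)
    ultimately show False by simp
  qed
  moreover have "exp (- 2 * of_real pi * \<i> * \<omega> * (Complex (-1) y / c)) \<noteq> 1"
    unfolding second_exponent_line[OF nz(2)]
    using exp_line_neq_1[of "c / \<omega>" y] assms by (simp add: direction_def exp_minus)
  ultimately show ?thesis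
    using exp_line_neq_1[of c y] assms unfolding regular_set_def direction_def by blast
qed

lemma open_regular_set: "open (regular_set \<omega>)"
proof -
  have "open (uminus -` (- \<real>\<^sub>\<le>\<^sub>0) :: complex set)"
    by (intro open_vimage continuous_intros) (auto simp: closed_nonpos_Reals_complex)
  moreover have "{t::complex. - t \<notin> \<real>\<^sub>\<le>\<^sub>0} = uminus -` (- \<real>\<^sub>\<le>\<^sub>0)"
    by auto
  ultimately have "open {t::complex. - t \<notin> \<real>\<^sub>\<le>\<^sub>0}"
    by simp
  then show ?thesis
    unfolding regular_set_def
    by (intro open_Collect_conj open_Collect_neq continuous_intros) auto
qed

lemma G_integrand_holomorphic: "G_integrand s \<omega> holomorphic_on regular_set \<omega>"
proof -
  have "(\<lambda>t. (- t) powr (s - 1) /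
       ((exp (2 * of_real pi * \<i> * t) - 1) * (exp (- 2 * of_real pi * \<i> * \<omega> * t) - 1)))
     holomorphic_on regular_set \<omega>"
    by (intro holomorphic_intros) (auto simp: regular_set_def)
  then show ?thesis
    by (simp add: G_integrand_def[abs_def])
qed

section \<open>Exponential decay along the lines\<close>

text \<open>The imaginary part is \<open>(y * Re c + Im c) / (norm c)\<^sup>2\<close>, and for
  \<open>2 * B \<le> \<bar>y\<bar>\<close> the term \<open>Im c\<close> costs at most
  \<open>\<bar>y\<bar> / 2\<close>. The factor \<open>sgn y\<close> treats both ends of the line
  together.\<close>

lemma Im_line_ge:
  assumes "Re c > 1" "norm c \<le> B" "2 * B \<le> \<bar>y\<bar>"
  shows "\<bar>y\<bar> / (2 * B\<^sup>2) \<le> sgn y * Im (Complex (-1) y / c)"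
proof -
  have B: "B > 1" using assms complex_Re_le_cmod[of c] by linarith
  have nc: "norm c > 1" using assms complex_Re_le_cmod[of c] by linarith
  have y: "y \<noteq> 0" using assms B by auto
  have eq: "Im (Complex (-1) y / c) = (y * Re c + Im c) / (norm c)\<^sup>2"
    by (simp add: Im_divide cmod_power2)
  have "\<bar>y\<bar> * 1 \<le> \<bar>y\<bar> * Re c" using assms by (intro mult_left_mono) auto
  moreover have "\<bar>sgn y * Im c\<bar> \<le> B"
    using abs_Im_le_cmod[of c] assms y by (auto simp: abs_mult sgn_real_def)
  moreover have "sgn y * (y * Re c + Im c) = \<bar>y\<bar> * Re c + sgn y * Im c"
    by (auto simp: algebra_simps sgn_real_def)
  ultimately have "\<bar>y\<bar> / 2 \<le> sgn y * (y * Re c + Im c)"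
    using assms(3) by linarith
  then have "(\<bar>y\<bar> / 2) / B\<^sup>2 \<le> (sgn y * (y * Re c + Im c)) / (norm c)\<^sup>2"
    using assms nc by (intro frac_le power_mono) auto
  then show ?thesis by (simp add: eq)
qed

text \<open>High in the upper half-plane the exponential has norm at most
  \<open>exp (-1) \<le> 1 / 2\<close>. A factor of this kind only has to stay away from zero; the
  decay comes from the other one.\<close>

lemma norm_exp_minus_1_ge_half:
  assumes "Im u \<ge> 1"
  shows "norm (exp (2 * of_real pi * \<i> * u) - 1) \<ge> 1 / 2"
proof -
  have "exp (- (2 * pi * Im u)) \<le> exp (-1)"
    using assms pi_gt3 mult_mono[of 1 "2*pi" 1 "Im u"] by simp
  also have "\<dots> \<le> (1/2 :: real)"
    using exp_ge_add_one_self[of "1::real"] by (simp add: exp_minus field_simps)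
  finally have "norm (exp (2 * of_real pi * \<i> * u)) \<le> 1/2"
    by simp
  then show ?thesis
    using norm_triangle_ineq2[of 1 "exp (2 * of_real pi * \<i> * u)"]
    by (simp add: norm_minus_commute)
qed

text \<open>Here the exponential has norm at least \<open>2\<close>, so subtracting \<open>1\<close>
  removes at most half of it.\<close>

lemma norm_exp_minus_1_ge_exp:
  assumes "Im u \<le> - d" "d \<ge> 1"
  shows "norm (exp (2 * of_real pi * \<i> * u) - 1) \<ge> exp (2 * pi * d) / 2"
proof -
  have d: "2 * pi * d \<ge> 1"
    using assms pi_gt3 mult_mono[of 1 "2*pi" 1 d] by simp
  have "exp (2 * pi * d) \<ge> 2"
    using exp_ge_add_one_self[of "2 * pi * d"] d by linarith
  moreover have "exp (2 * pi * d) \<le> norm (exp (2 * of_real pi * \<i> * u))"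
    using assms mult_left_mono[of d "- Im u" "2 * pi"] by simp
  ultimately show ?thesis
    using norm_triangle_ineq2[of "exp (2 * of_real pi * \<i> * u)" 1]
    unfolding norm_one by linarith
qed

text \<open>The exponent will be \<open>Re s - 1\<close>, of unknown sign; a bound \<open>M\<close>
  for both \<open>x\<close> and \<open>1 / x\<close> covers both cases.\<close>

lemma powr_le_powr_abs:
  fixes x M a :: real
  assumes "0 < x" "x \<le> M" "1 / x \<le> M"
  shows "x powr a \<le> M powr \<bar>a\<bar>"
proof (cases "a \<ge> 0")
  case True
  then show ?thesis using assms by (auto intro: powr_mono2)
next
  case False
  then have "x powr a = (1 / x) powr \<bar>a\<bar>"
    using assms by (simp add: powr_divide powr_minus_divide[symmetric])
  also have "\<dots> \<le> M powr \<bar>a\<bar>"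
    using assms by (intro powr_mono2) auto
  finally show ?thesis .
qed

text \<open>Far out on the line, the arguments \<open>t\<close> and \<open>u\<close> of the two
  factors lie in opposite half-planes: one factor is at least \<open>1 / 2\<close> and the other
  grows exponentially, which outweighs the power. The bound depends on \<open>c\<close> only through
  \<open>B\<close>.\<close>

lemma G_integrand_line_bound:
  assumes "direction \<omega> c" "norm c \<le> B" "norm (c / \<omega>) \<le> B" "2 * B\<^sup>2 \<le> \<bar>y\<bar>"
  shows "norm (G_integrand s \<omega> (Complex (-1) y / c)) \<le>
     4 * exp (\<bar>Im s\<bar> * pi) * (((1 + \<bar>y\<bar>) * B) powr \<bar>Re s - 1\<bar> * exp (- (pi / B\<^sup>2 * \<bar>y\<bar>)))"
proof -
  note nz = direction_nonzero[OF assms(1)]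
  have Re1: "Re c > 1" "Re (c / \<omega>) > 1" using assms by (auto simp: direction_def)
  have nc: "norm c > 1" using Re1 complex_Re_le_cmod[of c] by linarith
  have B: "B > 1" using nc assms by linarith
  have yB: "2 * B \<le> \<bar>y\<bar>"
    using assms(4) B mult_left_mono[of 1 B B] unfolding power2_eq_square by linarith
  define t where "t = Complex (-1) y / c"
  define u where "u = - (Complex (-1) y / (c / \<omega>))"
  define d where "d = \<bar>y\<bar> / (2 * B\<^sup>2)"
  \<comment> \<open>The threshold \<open>2 * B\<^sup>2\<close> is chosen for this: it brings
    \<open>t\<close> and \<open>u\<close> into the range of the two half-plane estimates.\<close>
  have d: "d \<ge> 1" using assms(4) B by (simp add: d_def field_simps)
  have Imt: "d \<le> sgn y * Im t" and Imu: "d \<le> - (sgn y * Im u)"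
    using Im_line_ge[OF Re1(1) assms(2) yB] Im_line_ge[OF Re1(2) assms(3) yB]
    by (simp_all add: t_def u_def d_def)
  have den: "exp (2 * pi * d) / 4 \<le>
    norm (exp (2 * of_real pi * \<i> * t) - 1) * norm (exp (2 * of_real pi * \<i> * u) - 1)"
  proof (cases "y > 0")
    case True
    then have "1 \<le> Im t" "Im u \<le> - d" using Imt Imu d by auto
    then have "1/2 * (exp (2 * pi * d) / 2) \<le>
      norm (exp (2 * of_real pi * \<i> * t) - 1) * norm (exp (2 * of_real pi * \<i> * u) - 1)"
      using d by (intro mult_mono norm_exp_minus_1_ge_half norm_exp_minus_1_ge_exp) auto
    then show ?thesis by simp
  next
    case False
    then have "y < 0" using yB B by auto
    then have "1 \<le> Im u" "Im t \<le> - d" using Imt Imu d by auto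
    then have "(exp (2 * pi * d) / 2) * (1/2) \<le>
      norm (exp (2 * of_real pi * \<i> * t) - 1) * norm (exp (2 * of_real pi * \<i> * u) - 1)"
      using d by (intro mult_mono norm_exp_minus_1_ge_half norm_exp_minus_1_ge_exp) auto
    then show ?thesis by simp
  qed
  have nw: "1 \<le> norm (Complex (-1) y)" "norm (Complex (-1) y) \<le> 1 + \<bar>y\<bar>"
    using abs_Re_le_cmod[of "Complex (-1) y"] cmod_le[of "Complex (-1) y"] by auto
  have nt: "norm t = norm (Complex (-1) y) / norm c"
    by (simp add: t_def norm_divide)
  have t0: "norm t > 0" unfolding nt using nw nc by (intro divide_pos_pos) linarith+
  have "norm (Complex (-1) y) / norm c \<le> (1 + \<bar>y\<bar>) * B / 1"
  proof (rule frac_le)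
    have "norm (Complex (-1) y) * 1 \<le> (1 + \<bar>y\<bar>) * B"
      using nw B by (intro mult_mono) auto
    then show "norm (Complex (-1) y) \<le> (1 + \<bar>y\<bar>) * B" by simp
  qed (use nc B in auto)
  then have up: "norm t \<le> (1 + \<bar>y\<bar>) * B" by (simp add: nt)
  have "1 / norm t = norm c / norm (Complex (-1) y)" by (simp add: nt)
  also have "\<dots> \<le> B / 1"
    using nw assms B by (intro frac_le) auto
  also have "\<dots> \<le> (1 + \<bar>y\<bar>) * B" using B by (simp add: field_simps)
  finally have lo: "1 / norm t \<le> (1 + \<bar>y\<bar>) * B" .
  \<comment> \<open>The norm of the complex power also contains
    \<open>exp (- Im s * Arg (- t))\<close>, which is bounded since the principal argument
    is.\<close>
  have "- Im s * Arg (- t) \<le> \<bar>Im s\<bar> * \<bar>Arg (- t)\<bar>"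
    by (metis abs_ge_self abs_minus_cancel abs_mult)
  also have "\<dots> \<le> \<bar>Im s\<bar> * pi"
    using Arg_bounded[of "- t"] by (intro mult_left_mono) auto
  finally have arg: "- Im s * Arg (- t) \<le> \<bar>Im s\<bar> * pi" .
  have num: "norm ((- t) powr (s - 1)) \<le> ((1 + \<bar>y\<bar>) * B) powr \<bar>Re s - 1\<bar> * exp (\<bar>Im s\<bar> * pi)"
    unfolding norm_powr_complex using powr_le_powr_abs[OF t0 up lo, of "Re s - 1"] arg
    by (intro mult_mono) auto
  have "norm (G_integrand s \<omega> t) = norm ((- t) powr (s - 1)) /
    (norm (exp (2 * of_real pi * \<i> * t) - 1) * norm (exp (2 * of_real pi * \<i> * u) - 1))"
    unfolding G_integrand_def u_def t_def second_exponent_line[OF nz(2)]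
    by (simp only: norm_divide norm_mult)
  also have "\<dots> \<le> ((1 + \<bar>y\<bar>) * B) powr \<bar>Re s - 1\<bar> * exp (\<bar>Im s\<bar> * pi) / (exp (2 * pi * d) / 4)"
    using num den by (intro frac_le) auto
  also have "\<dots> = 4 * exp (\<bar>Im s\<bar> * pi) * (((1 + \<bar>y\<bar>) * B) powr \<bar>Re s - 1\<bar> * exp (- (2 * pi * d)))"
    by (simp add: exp_minus field_simps)
  also have "2 * pi * d = pi / B\<^sup>2 * \<bar>y\<bar>"
    by (simp add: d_def)
  finally show ?thesis by (simp add: t_def)
qed

text \<open>\<open>C\<close> and \<open>Y\<close> are chosen before \<open>c\<close>, so the
  estimate is uniform in bounded directions. The quadratic rate gives integrability and still beats
  the linear growth of the boundary terms met later.\<close>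

lemma G_integrand_line_decay:
  assumes "B \<ge> 1"
  shows "\<exists>C Y. \<forall>c y. direction \<omega> c \<longrightarrow> norm c \<le> B \<longrightarrow> norm (c / \<omega>) \<le> B \<longrightarrow> Y \<le> \<bar>y\<bar> \<longrightarrow>
     norm (G_integrand s \<omega> (Complex (-1) y / c)) \<le> C / (1 + y\<^sup>2)"
proof -
  have "((\<lambda>x. ((1 + x) * B) powr p * exp (- (a * x)) * (1 + x\<^sup>2)) \<longlongrightarrow> 0) at_top"
    if "a > 0" "p \<ge> 0" "B > 0" for a p :: real
    using that by real_asymp
  from this[of "pi / B\<^sup>2" "\<bar>Re s - 1\<bar>"] assms
  have "((\<lambda>x. ((1 + x) * B) powr \<bar>Re s - 1\<bar> * exp (- (pi / B\<^sup>2 * x)) * (1 + x\<^sup>2)) \<longlongrightarrow> 0) at_top"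
    by simp
  then have "\<forall>\<^sub>F x in at_top. ((1 + x) * B) powr \<bar>Re s - 1\<bar> * exp (- (pi / B\<^sup>2 * x)) * (1 + x\<^sup>2) < 1"
    by (rule order_tendstoD) simp
  then obtain Y where Y: "\<And>x. x \<ge> Y \<Longrightarrow>
      ((1 + x) * B) powr \<bar>Re s - 1\<bar> * exp (- (pi / B\<^sup>2 * x)) * (1 + x\<^sup>2) < 1"
    by (auto simp: eventually_at_top_linorder)
  show ?thesis
  proof (intro exI allI impI)
    fix c y assume *: "direction \<omega> c" "norm c \<le> B" "norm (c / \<omega>) \<le> B" "max Y (2 * B\<^sup>2) \<le> \<bar>y\<bar>"
    have pos: "1 + y\<^sup>2 > 0" by (simp add: add_pos_nonneg)
    have "((1 + \<bar>y\<bar>) * B) powr \<bar>Re s - 1\<bar> * exp (- (pi / B\<^sup>2 * \<bar>y\<bar>)) * (1 + y\<^sup>2) < 1"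
      using Y[of "\<bar>y\<bar>"] * by simp
    then have "((1 + \<bar>y\<bar>) * B) powr \<bar>Re s - 1\<bar> * exp (- (pi / B\<^sup>2 * \<bar>y\<bar>)) \<le> 1 / (1 + y\<^sup>2)"
      using pos by (simp add: pos_le_divide_eq)
    then have "4 * exp (\<bar>Im s\<bar> * pi) * (((1 + \<bar>y\<bar>) * B) powr \<bar>Re s - 1\<bar> * exp (- (pi / B\<^sup>2 * \<bar>y\<bar>)))
       \<le> 4 * exp (\<bar>Im s\<bar> * pi) * (1 / (1 + y\<^sup>2))"
      by (intro mult_left_mono) auto
    moreover have y: "2 * B\<^sup>2 \<le> \<bar>y\<bar>" using *(4) by simp
    ultimately show "norm (G_integrand s \<omega> (Complex (-1) y / c)) \<le> 4 * exp (\<bar>Im s\<bar> * pi) / (1 + y\<^sup>2)"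
      using G_integrand_line_bound[OF *(1,2,3) y, of s] by simp
  qed
qed

section \<open>Absolute convergence of the line integrals\<close>

lemma continuous_on_Complex [continuous_intros]:
  "continuous_on S f \<Longrightarrow> continuous_on S g \<Longrightarrow> continuous_on S (\<lambda>x. Complex (f x) (g x))"
  unfolding Complex_eq by (intro continuous_intros)

lemma continuous_line_integrand:
  assumes "direction \<omega> c"
  shows "continuous_on S (line_integrand s \<omega> c)"
proof -
  have "continuous_on S (\<lambda>y. G_integrand s \<omega> (Complex (-1) y / c))"
    by (rule continuous_on_compose2[OF holomorphic_on_imp_continuous_on[OF G_integrand_holomorphic[of s \<omega>]]])
      (use direction_nonzero[OF assms] line_in_regular_set[OF assms] in \<open>auto intro!: continuous_intros\<close>)
  then show ?thesis
    unfolding line_integrand_def by (intro continuous_intros) (use direction_nonzero[OF assms] in auto)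
qed

text \<open>On \<open>{-Y..Y}\<close> compactness bounds
  \<open>(1 + y\<^sup>2) *\<^sub>R f y\<close>, so one multiple of
  \<open>inverse (1 + y\<^sup>2)\<close> dominates \<open>f\<close> everywhere.\<close>

lemma integrable_of_decay:
  fixes f :: "real \<Rightarrow> complex"
  assumes cont: "continuous_on UNIV f" and decay: "\<And>y. Y \<le> \<bar>y\<bar> \<Longrightarrow> norm (f y) \<le> C / (1 + y\<^sup>2)"
  shows "integrable lborel f"
proof -
  have "compact ((\<lambda>y. (1 + y\<^sup>2) *\<^sub>R f y) ` {-Y..Y})"
    by (intro compact_continuous_image continuous_intros continuous_on_subset[OF cont]) auto
  then have "bounded ((\<lambda>y. (1 + y\<^sup>2) *\<^sub>R f y) ` {-Y..Y})"
    by (rule compact_imp_bounded)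
  then obtain M where "\<forall>z \<in> (\<lambda>y. (1 + y\<^sup>2) *\<^sub>R f y) ` {-Y..Y}. norm z \<le> M"
    unfolding bounded_iff by (rule exE)
  then have M: "\<And>y. y \<in> {-Y..Y} \<Longrightarrow> norm ((1 + y\<^sup>2) *\<^sub>R f y) \<le> M"
    by (simp only: ball_simps)
  have pos: "1 + y\<^sup>2 > 0" for y :: real by (simp add: add_pos_nonneg)
  have bnd: "norm (f y) \<le> max M C * inverse (1 + y\<^sup>2)" for y
  proof -
    have "norm (f y) * (1 + y\<^sup>2) \<le> max M C"
    proof (cases "Y \<le> \<bar>y\<bar>")
      case True
      then show ?thesis using decay[of y] pos[of y] by (simp add: field_simps)
    next
      case False
      then have "y \<in> {-Y..Y}" by auto
      then have "norm (f y) * (1 + y\<^sup>2) \<le> M" using M[of y] pos[of y] by (simp add: mult.commute)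
      then show ?thesis by simp
    qed
    then show ?thesis using pos[of y] by (simp add: field_simps)
  qed
  have "integrable lborel (\<lambda>y::real. inverse (1 + y\<^sup>2))"
    using integrable_inverse_1_plus_square by (simp add: set_integrable_def)
  then have "integrable lborel (\<lambda>y::real. max M C * inverse (1 + y\<^sup>2))"
    by (rule integrable_mult_right)
  then show ?thesis
  proof (rule Bochner_Integration.integrable_bound)
    show "f \<in> borel_measurable lborel"
      using borel_measurable_continuous_onI[OF cont] by simp
    show "AE y in lborel. norm (f y) \<le> norm (max M C * inverse (1 + y\<^sup>2))"
      by (intro AE_I2 order_trans[OF bnd]) simp
  qed
qed

lemma integrable_line_integrand:
  assumes "direction \<omega> c"
  shows "integrable lborel (line_integrand s \<omega> c)"
proof -
  define B where "B = max 1 (max (norm c) (norm (c / \<omega>)))"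
  have B: "1 \<le> B" "norm c \<le> B" "norm (c / \<omega>) \<le> B" by (auto simp: B_def)
  obtain C Y where
    "\<And>c y. direction \<omega> c \<Longrightarrow> norm c \<le> B \<Longrightarrow> norm (c / \<omega>) \<le> B \<Longrightarrow> Y \<le> \<bar>y\<bar> \<Longrightarrow>
     norm (G_integrand s \<omega> (Complex (-1) y / c)) \<le> C / (1 + y\<^sup>2)"
    using G_integrand_line_decay[OF B(1), of \<omega> s] by blast
  note CY = this[OF assms B(2,3)]
  show ?thesis
  proof (rule integrable_of_decay[OF continuous_line_integrand[OF assms]])
    fix y assume "Y \<le> \<bar>y\<bar>"
    then have "norm (G_integrand s \<omega> (Complex (-1) y / c)) * norm (\<i> / c) \<le> C / (1 + y\<^sup>2) * norm (\<i> / c)"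
      by (intro mult_right_mono CY) auto
    then show "norm (line_integrand s \<omega> c y) \<le> (C * norm (\<i> / c)) / (1 + y\<^sup>2)"
      unfolding line_integrand_def norm_mult by simp
  qed
qed

section \<open>Independence of the line\<close>

lemma convex_direction: "convex {c. direction \<omega> c}"
proof -
  have "convex ((\<lambda>c. c / \<omega>) -` {z. Re z > 1})"
    by (intro convex_linear_vimage convex_halfspace_Re_gt bounded_linear.linear[OF bounded_linear_divide])
  then have "convex ({z. Re z > 1} \<inter> (\<lambda>c. c / \<omega>) -` {z. Re z > 1})"
    by (intro convex_Int convex_halfspace_Re_gt)
  moreover have "{c. direction \<omega> c} = {z. Re z > 1} \<inter> (\<lambda>c. c / \<omega>) -` {z. Re z > 1}"
    by (auto simp: direction_def)
  ultimately show ?thesis by simp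
qed

lemma direction_closed_segment:
  assumes "direction \<omega> c1" "direction \<omega> c2" "c \<in> closed_segment c1 c2"
  shows "direction \<omega> c"
  using closed_segment_subset[OF _ _ convex_direction, of c1 \<omega> c2] assms by blast

text \<open>Put \<open>t = Complex (-1) y / c\<close>. The integrand is \<open>g(t)\<close> times
  the \<open>y\<close>-derivative of \<open>t\<close>, and \<open>P c y\<close> is
  \<open>g(t)\<close> times the \<open>c\<close>-derivative of \<open>t\<close>. As \<open>g\<close>
  is holomorphic, the \<open>c\<close>-derivative of the former equals the
  \<open>y\<close>-derivative of the latter: this is Cauchy's theorem in infinitesimal form.\<close>

lemma truncated_line_integral_derivative:
  fixes s :: complex
  assumes "direction \<omega> c0" "a \<le> b"
  defines "P \<equiv> \<lambda>c y. - (Complex (-1) y * G_integrand s \<omega> (Complex (-1) y / c) / c\<^sup>2)"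
  shows "((\<lambda>c. integral {a..b} (line_integrand s \<omega> c)) has_field_derivative (P c0 b - P c0 a))
    (at c0 within {c. direction \<omega> c})"
proof -
  define g where "g = G_integrand s \<omega>"
  have hol: "g holomorphic_on regular_set \<omega>"
    unfolding g_def by (rule G_integrand_holomorphic)
  have g': "(g has_field_derivative deriv g t) (at t)" if "t \<in> regular_set \<omega>" for t
    using holomorphic_derivI[OF hol open_regular_set that] .
  have cg: "continuous_on (regular_set \<omega>) g" "continuous_on (regular_set \<omega>) (deriv g)"
    using hol holomorphic_deriv[OF hol open_regular_set] by (auto intro: holomorphic_on_imp_continuous_on)
  \<comment> \<open>\<open>D\<close> is the common value of the two mixed derivatives. It is met
    first as the \<open>c\<close>-derivative of the integrand, then as the
    \<open>y\<close>-derivative of \<open>P\<close>.\<close>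
  define D where "D = (\<lambda>c y. - (deriv g (Complex (-1) y / c) * Complex (-1) y * \<i> / c ^ 3)
      - g (Complex (-1) y / c) * \<i> / c\<^sup>2)"
  have "((\<lambda>c. integral (cbox a b) (line_integrand s \<omega> c)) has_field_derivative
      integral (cbox a b) (D c0)) (at c0 within {c. direction \<omega> c})"
  \<comment> \<open>Differentiation under the integral sign takes place over a convex set of
    parameters, here the set of all directions.\<close>
  proof (rule leibniz_rule_field_derivative)
    fix c y assume "c \<in> {c. direction \<omega> c}"
    then have c: "direction \<omega> c" by simp
    note reg = line_in_regular_set[OF c, of y] and nz = direction_nonzero[OF c]
    have "((\<lambda>c. g (Complex (-1) y / c)) has_field_derivative
        deriv g (Complex (-1) y / c) * (- (Complex (-1) y / c\<^sup>2))) (at c within {c. direction \<omega> c})"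
      by (rule DERIV_chain2[where f = g and g = "\<lambda>c. Complex (-1) y / c", OF g'[OF reg]])
         (use nz in \<open>auto intro!: derivative_eq_intros simp: power2_eq_square\<close>)
    then have "((\<lambda>c. g (Complex (-1) y / c) * (\<i> / c)) has_field_derivative
        deriv g (Complex (-1) y / c) * (- (Complex (-1) y / c\<^sup>2)) * (\<i> / c)
        + - (\<i> / c\<^sup>2) * g (Complex (-1) y / c)) (at c within {c. direction \<omega> c})"
      by (rule DERIV_mult)
         (use nz in \<open>auto intro!: derivative_eq_intros simp: power2_eq_square\<close>)
    moreover have "deriv g (Complex (-1) y / c) * (- (Complex (-1) y / c\<^sup>2)) * (\<i> / c)
        + - (\<i> / c\<^sup>2) * g (Complex (-1) y / c) = D c y"
      using nz by (simp add: D_def field_simps power2_eq_square power3_eq_cube)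
    ultimately show "((\<lambda>c. line_integrand s \<omega> c y) has_field_derivative D c y)
        (at c within {c. direction \<omega> c})"
      by (simp add: line_integrand_def g_def)
  next
    fix c assume "c \<in> {c. direction \<omega> c}"
    then show "line_integrand s \<omega> c integrable_on cbox a b"
      by (intro integrable_continuous continuous_line_integrand) simp
  next
    show "continuous_on ({c. direction \<omega> c} \<times> cbox a b) (\<lambda>(c, y). D c y)"
      unfolding D_def case_prod_unfold
      by (intro continuous_intros continuous_on_compose2[OF cg(1)] continuous_on_compose2[OF cg(2)])
         (auto simp: direction_nonzero line_in_regular_set)
  qed (use assms convex_direction in auto)
  moreover have "(D c0 has_integral P c0 b - P c0 a) {a..b}"
  proof (rule fundamental_theorem_of_calculus[OF assms(2)])
    fix y assume "y \<in> {a..b}"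
    note reg = line_in_regular_set[OF assms(1), of y] and nz = direction_nonzero[OF assms(1)]
    have w: "(Complex (-1) has_vector_derivative \<i>) (at y within {a..b})"
      unfolding Complex_eq by (auto intro!: derivative_eq_intros)
    \<comment> \<open>\<open>P c0\<close> is a holomorphic expression in
      \<open>z = Complex (-1) y\<close>; it is differentiated in \<open>z\<close> first and then
      composed with the path, whose velocity is \<open>\<i>\<close>.\<close>
    have "((\<lambda>z. - (z * g (z / c0) / c0\<^sup>2)) has_field_derivative
        - ((g (Complex (-1) y / c0) + Complex (-1) y * (deriv g (Complex (-1) y / c0) * (1 / c0))) / c0\<^sup>2))
        (at (Complex (-1) y) within Complex (-1) ` {a..b})"
    proof -
      have "((\<lambda>z. g (z / c0)) has_field_derivative deriv g (Complex (-1) y / c0) * (1 / c0))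
          (at (Complex (-1) y) within Complex (-1) ` {a..b})"
        by (rule DERIV_chain2[where f = g and g = "\<lambda>z. z / c0", OF g'[OF reg]])
           (use nz in \<open>auto intro!: derivative_eq_intros\<close>)
      from DERIV_minus[OF DERIV_cdivide[OF DERIV_mult[OF DERIV_ident this], of "c0\<^sup>2"]]
      show ?thesis
        by (simp add: mult.commute add.commute)
    qed
    from field_vector_diff_chain_within[OF w this]
    have "(P c0 has_vector_derivative \<i> *
       - ((g (Complex (-1) y / c0) + Complex (-1) y * (deriv g (Complex (-1) y / c0) * (1 / c0))) / c0\<^sup>2))
       (at y within {a..b})"
      by (simp add: P_def g_def o_def)
    moreover have "\<i> * - ((g (Complex (-1) y / c0) + Complex (-1) y * (deriv g (Complex (-1) y / c0) * (1 / c0))) / c0\<^sup>2)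
       = D c0 y"
      using nz by (simp add: D_def field_simps power2_eq_square power3_eq_cube)
    ultimately show "(P c0 has_vector_derivative D c0 y) (at y within {a..b})"
      by simp
  qed
  ultimately show ?thesis
    by (simp add: integral_unique)
qed

text \<open>A product of linear growth with decay of order \<open>1 / (1 + y\<^sup>2)\<close> tends
  to zero. One \<open>R\<close> serves the whole segment because the bounds on \<open>norm c\<close>
  and \<open>norm (c / \<omega>)\<close> are convex conditions, inherited from the
  endpoints.\<close>

lemma G_integrand_boundary_small:
  assumes "direction \<omega> c1" "direction \<omega> c2" "e > 0"
  shows "\<exists>R. \<forall>c\<in>closed_segment c1 c2. \<forall>y. R \<le> \<bar>y\<bar> \<longrightarrow>
     norm (Complex (-1) y * G_integrand s \<omega> (Complex (-1) y / c) / c\<^sup>2) \<le> e"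
proof -
  define B where "B = max 1 (max (max (norm c1) (norm c2)) (max (norm (c1 / \<omega>)) (norm (c2 / \<omega>))))"
  have B: "1 \<le> B" by (auto simp: B_def)
  have conv: "convex ({c. norm c \<le> B} \<inter> (\<lambda>c. c / \<omega>) -` {c. norm c \<le> B})"
  proof -
    have "convex {c::complex. norm c \<le> B}"
      using convex_cball[of "0::complex" B] by (simp add: cball_def)
    then show ?thesis
      by (intro convex_Int convex_linear_vimage bounded_linear.linear[OF bounded_linear_divide])
  qed
  have seg: "norm c \<le> B \<and> norm (c / \<omega>) \<le> B" if "c \<in> closed_segment c1 c2" for c
  proof -
    have "{c1, c2} \<subseteq> {c. norm c \<le> B} \<inter> (\<lambda>c. c / \<omega>) -` {c. norm c \<le> B}"
      by (auto simp: B_def)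
    then show ?thesis
      using closed_segment_subset[of c1 "{c. norm c \<le> B} \<inter> (\<lambda>c. c / \<omega>) -` {c. norm c \<le> B}" c2] that conv
      by blast
  qed
  obtain C Y where CY: "\<And>c y. direction \<omega> c \<Longrightarrow> norm c \<le> B \<Longrightarrow> norm (c / \<omega>) \<le> B \<Longrightarrow> Y \<le> \<bar>y\<bar> \<Longrightarrow>
     norm (G_integrand s \<omega> (Complex (-1) y / c)) \<le> C / (1 + y\<^sup>2)"
    using G_integrand_line_decay[OF B, of \<omega> s] by blast
  have "((\<lambda>x. (1 + x) * (C / (1 + x\<^sup>2))) \<longlongrightarrow> 0) at_top"
    by real_asymp
  then have "\<forall>\<^sub>F x in at_top. (1 + x) * (C / (1 + x\<^sup>2)) < e"
    by (rule order_tendstoD) (use assms in simp)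
  then obtain Z where Z: "\<And>x. x \<ge> Z \<Longrightarrow> (1 + x) * (C / (1 + x\<^sup>2)) < e"
    by (auto simp: eventually_at_top_linorder)
  show ?thesis
  proof (intro exI ballI allI impI)
    fix c y assume c: "c \<in> closed_segment c1 c2" and y: "max Y Z \<le> \<bar>y\<bar>"
    have dir: "direction \<omega> c" by (rule direction_closed_segment[OF assms(1,2) c])
    then have "norm c > 1"
      using complex_Re_le_cmod[of c] by (simp add: direction_def)
    \<comment> \<open>Hence the division by \<open>c\<^sup>2\<close> can only decrease the
      norm.\<close>
    then have "1 \<le> (norm c)\<^sup>2" by simp
    have nw: "norm (Complex (-1) y) \<le> 1 + \<bar>y\<bar>"
      using cmod_le[of "Complex (-1) y"] by simp
    have "norm (Complex (-1) y * G_integrand s \<omega> (Complex (-1) y / c) / c\<^sup>2) =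
      norm (Complex (-1) y) * norm (G_integrand s \<omega> (Complex (-1) y / c)) / (norm c)\<^sup>2"
      by (simp only: norm_divide norm_mult norm_power)
    also have "\<dots> \<le> ((1 + \<bar>y\<bar>) * (C / (1 + y\<^sup>2))) / 1"
    proof (rule frac_le)
      show *: "norm (Complex (-1) y) * norm (G_integrand s \<omega> (Complex (-1) y / c)) \<le> (1 + \<bar>y\<bar>) * (C / (1 + y\<^sup>2))"
        using seg[OF c] y by (intro mult_mono nw CY dir) auto
      show "0 \<le> (1 + \<bar>y\<bar>) * (C / (1 + y\<^sup>2))"
        by (rule order_trans[OF _ *]) simp
    qed (use \<open>1 \<le> (norm c)\<^sup>2\<close> in auto)
    also have "\<dots> \<le> e"
      using Z[of "\<bar>y\<bar>"] y by simp
    finally show "norm (Complex (-1) y * G_integrand s \<omega> (Complex (-1) y / c) / c\<^sup>2) \<le> e" .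
  qed
qed

text \<open>The mean value inequality along the segment from \<open>c1\<close> to \<open>c2\<close>
  bounds the change of the truncated integral by its two boundary terms.\<close>

lemma line_integral_independent:
  assumes d: "direction \<omega> c1" "direction \<omega> c2"
  shows "integral\<^sup>L lborel (line_integrand s \<omega> c1) = integral\<^sup>L lborel (line_integrand s \<omega> c2)"
proof -
  define J where "J = (\<lambda>c. integral\<^sup>L lborel (line_integrand s \<omega> c))"
  \<comment> \<open>The gauge integral over \<open>UNIV\<close> is the limit over large boxes, which
    allows truncation to \<open>{-R..R}\<close>.\<close>
  have trunc: "\<exists>R1. \<forall>R\<ge>R1. norm (integral {-R..R} (line_integrand s \<omega> c) - J c) < e"
    if dir: "direction \<omega> c" and e: "e > 0" for c e
  proof -
    have "(line_integrand s \<omega> c has_integral J c) UNIV"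
      unfolding J_def by (rule has_integral_integral_lborel[OF integrable_line_integrand[OF dir]])
    then obtain B where B: "\<And>a b. ball 0 B \<subseteq> cbox a b \<Longrightarrow>
        norm (integral (cbox a b) (line_integrand s \<omega> c) - J c) < e"
      using e unfolding has_integral_alt'[of _ _ UNIV] by (simp del: cbox_interval) blast
    have "ball 0 B \<subseteq> cbox (-R) R" if "R \<ge> B" for R :: real
      using that by (auto simp: dist_real_def)
    then show ?thesis using B by (metis cbox_interval)
  qed
  have "norm (J c1 - J c2) \<le> e" if "e > 0" for e
  proof -
    \<comment> \<open>The two truncation errors together stay below \<open>3 * \<delta>\<close>, and
      the boundary terms contribute at most \<open>2 * \<delta> * norm (c1 - c2)\<close>.\<close>
    define K where "K = 3 + 2 * norm (c1 - c2)"
    have K: "K > 0" by (simp add: K_def add_pos_nonneg)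
    define \<delta> where "\<delta> = e / K"
    have \<delta>: "\<delta> > 0" using that K by (simp add: \<delta>_def)
    obtain R1 where R1: "\<And>R. R \<ge> R1 \<Longrightarrow> norm (integral {-R..R} (line_integrand s \<omega> c1) - J c1) < \<delta>"
      using trunc[OF d(1) \<delta>] by blast
    obtain R2 where R2: "\<And>R. R \<ge> R2 \<Longrightarrow> norm (integral {-R..R} (line_integrand s \<omega> c2) - J c2) < \<delta>"
      using trunc[OF d(2) \<delta>] by blast
    obtain R0 where R0: "\<And>c y. c \<in> closed_segment c1 c2 \<Longrightarrow> R0 \<le> \<bar>y\<bar> \<Longrightarrow>
       norm (Complex (-1) y * G_integrand s \<omega> (Complex (-1) y / c) / c\<^sup>2) \<le> \<delta>"
      using G_integrand_boundary_small[OF d \<delta>, of s] by blast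
    define R where "R = max 0 (max R0 (max R1 R2))"
    have R: "0 \<le> R" "R0 \<le> R" "R1 \<le> R" "R2 \<le> R" by (auto simp: R_def)
    define P where "P = (\<lambda>c y. - (Complex (-1) y * G_integrand s \<omega> (Complex (-1) y / c) / c\<^sup>2))"
    have "norm (integral {-R..R} (line_integrand s \<omega> c1) - integral {-R..R} (line_integrand s \<omega> c2))
       \<le> (2 * \<delta>) * norm (c1 - c2)"
    proof (rule field_differentiable_bound)
      fix c assume c: "c \<in> closed_segment c1 c2"
      show "((\<lambda>c. integral {-R..R} (line_integrand s \<omega> c)) has_field_derivative (P c R - P c (-R)))
          (at c within closed_segment c1 c2)"
        using truncated_line_integral_derivative[OF direction_closed_segment[OF d c], of "-R" R s] R
        unfolding P_def
        by (rule_tac DERIV_subset) (auto intro: direction_closed_segment[OF d])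
      have "norm (P c R) \<le> \<delta>" "norm (P c (-R)) \<le> \<delta>"
        unfolding P_def norm_minus_cancel using R0[OF c] R by auto
      then show "norm (P c R - P c (-R)) \<le> 2 * \<delta>"
        using norm_triangle_ineq4[of "P c R" "P c (-R)"] by linarith
    qed auto
    moreover note R1[OF R(3)] R2[OF R(4)]
    moreover have "norm (J c1 - J c2) \<le> norm (integral {-R..R} (line_integrand s \<omega> c1) - J c1)
      + norm (integral {-R..R} (line_integrand s \<omega> c1) - integral {-R..R} (line_integrand s \<omega> c2))
      + norm (integral {-R..R} (line_integrand s \<omega> c2) - J c2)"
      by norm
    moreover have "\<delta> * K = 3 * \<delta> + 2 * \<delta> * norm (c1 - c2)"
      by (simp add: K_def algebra_simps)
    ultimately have "norm (J c1 - J c2) \<le> \<delta> * K"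
      using \<delta> by linarith
    then show ?thesis using K by (simp add: \<delta>_def)
  qed
  then have "norm (J c1 - J c2) \<le> 0"
    by (rule field_le_epsilon) simp
  then show ?thesis by (simp add: J_def)
qed

section \<open>The value of \<open>G\<close> as an integral along a single line\<close>

lemma direction_of_admissible:
  assumes "admissible \<omega> \<eta> \<epsilon>"
  shows "direction \<omega> (cis (- \<eta>) / of_real \<epsilon>)"
proof -
  have "cis (- \<eta>) / of_real \<epsilon> / \<omega> = cis (- \<eta>) * inverse \<omega> / of_real \<epsilon>"
    by (simp add: field_simps)
  then show ?thesis
    using assms unfolding direction_def admissible_def
    by (simp only: Re_divide_of_real) (simp add: field_simps)
qed

text \<open>\<open>Re c > 0\<close> confines \<open>Arg c\<close> to the open right half-plane
  range, and dividing by \<open>norm c\<close> normalises the direction. This provides the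
  admissible contour on which the uniqueness of the value in \<open>G\<close> rests.\<close>

lemma admissible_of_direction:
  assumes "direction \<omega> c"
  shows "admissible \<omega> (- Arg c) (1 / norm c)"
proof -
  note nz = direction_nonzero[OF assms]
  have c: "cis (Arg c) = c / of_real (norm c)"
    using nz by (simp add: cis_Arg sgn_eq)
  have "\<bar>Im (Ln c)\<bar> < pi / 2"
    using assms nz by (subst Re_Ln_pos_lt) (auto simp: direction_def)
  then have 1: "- Arg c \<in> {-pi/2<..<pi/2}"
    unfolding Arg_eq_Im_Ln[OF nz(1)] by (simp only: greaterThanLessThan_iff) linarith
  have "cos (- Arg c) = Re (c / of_real (norm c))"
    by (metis c cis.simps(1) cos_minus)
  then have 2: "cos (- Arg c) = Re c / norm c"
    by (simp only: Re_divide_of_real)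
  have "cis (- (- Arg c)) * inverse \<omega> = (c / \<omega>) / of_real (norm c)"
    unfolding minus_minus c by (simp add: field_simps)
  then have 3: "Re (cis (- (- Arg c)) * inverse \<omega>) = Re (c / \<omega>) / norm c"
    by (simp only: Re_divide_of_real)
  show ?thesis
    unfolding admissible_def 2 3 using 1 assms nz
    by (auto simp: direction_def intro!: divide_strict_right_mono)
qed

text \<open>The two parametrisations of the same line differ by the substitution of
  \<open>\<epsilon> * y\<close> for \<open>y\<close>; its Jacobian \<open>\<epsilon>\<close> turns
  \<open>\<i> * cis \<eta>\<close> into \<open>\<i> / c\<close>.\<close>

lemma has_bochner_integral_contour_iff_line:
  assumes "admissible \<omega> \<eta> \<epsilon>"
  shows "has_bochner_integral lborel (\<lambda>y. G_integrand s \<omega> (contour \<eta> \<epsilon> y) * (\<i> * cis \<eta>)) I \<longleftrightarrow>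
    has_bochner_integral lborel (line_integrand s \<omega> (cis (- \<eta>) / of_real \<epsilon>)) I"
proof -
  have \<epsilon>: "\<epsilon> > 0" using assms by (simp add: admissible_def)
  define h where "h = (\<lambda>y. G_integrand s \<omega> (contour \<eta> \<epsilon> y) * (\<i> * cis \<eta>))"
  have inv: "1 / cis (- \<eta>) = cis \<eta>"
    by (simp add: divide_inverse cis_inverse)
  have line: "line_integrand s \<omega> (cis (- \<eta>) / of_real \<epsilon>) y = \<epsilon> *\<^sub>R h (0 + \<epsilon> * y)" for y
  proof -
    have "Complex (-1) y / (cis (- \<eta>) / of_real \<epsilon>) = Complex (-1) y * of_real \<epsilon> * (1 / cis (- \<eta>))"
      by simp
    also have "\<dots> = contour \<eta> \<epsilon> (\<epsilon> * y)"
      unfolding inv contour_def by (simp add: Complex_eq algebra_simps)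
    finally have 1: "Complex (-1) y / (cis (- \<eta>) / of_real \<epsilon>) = contour \<eta> \<epsilon> (\<epsilon> * y)" .
    have "\<i> / (cis (- \<eta>) / of_real \<epsilon>) = \<i> * of_real \<epsilon> * (1 / cis (- \<eta>))"
      by simp
    then have 2: "\<i> / (cis (- \<eta>) / of_real \<epsilon>) = of_real \<epsilon> * (\<i> * cis \<eta>)"
      unfolding inv by (simp add: algebra_simps)
    show ?thesis
      unfolding line_integrand_def 1 2 h_def by (simp add: scaleR_conv_of_real)
  qed
  have "has_bochner_integral lborel h I \<longleftrightarrow> has_bochner_integral lborel (\<lambda>y. h (0 + \<epsilon> * y)) (I /\<^sub>R \<bar>\<epsilon>\<bar>)"
    using \<epsilon> by (intro lborel_has_bochner_integral_real_affine_iff) simp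
  also have "\<dots> \<longleftrightarrow> has_bochner_integral lborel (\<lambda>y. \<epsilon> *\<^sub>R h (0 + \<epsilon> * y)) I"
  proof
    assume "has_bochner_integral lborel (\<lambda>y. h (0 + \<epsilon> * y)) (I /\<^sub>R \<bar>\<epsilon>\<bar>)"
    from has_bochner_integral_scaleR_right[OF this, of \<epsilon>] \<epsilon>
    show "has_bochner_integral lborel (\<lambda>y. \<epsilon> *\<^sub>R h (0 + \<epsilon> * y)) I" by simp
  next
    assume "has_bochner_integral lborel (\<lambda>y. \<epsilon> *\<^sub>R h (0 + \<epsilon> * y)) I"
    from has_bochner_integral_scaleR_right[OF this, of "inverse \<epsilon>"] \<epsilon>
    show "has_bochner_integral lborel (\<lambda>y. h (0 + \<epsilon> * y)) (I /\<^sub>R \<bar>\<epsilon>\<bar>)" by simp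
  qed
  finally show ?thesis
    unfolding h_def[symmetric] line[abs_def] .
qed

text \<open>Independence of the line shows that the description of \<open>G\<close> is satisfiable,
  and one admissible contour, obtained from \<open>c\<close>, shows that it determines the
  value.\<close>

lemma has_bochner_integral_line_G:
  assumes "direction \<omega> c"
  shows "has_bochner_integral lborel (line_integrand s \<omega> c) (G s \<omega>)"
proof -
  define J where "J = integral\<^sup>L lborel (line_integrand s \<omega> c)"
  have J: "has_bochner_integral lborel (line_integrand s \<omega> c') J" if "direction \<omega> c'" for c'
    using line_integral_independent[OF assms that] integrable_line_integrand[OF that]
    by (simp add: J_def has_bochner_integral_iff)
  have "G s \<omega> = J"
    unfolding G_def
  proof (rule the_equality)
    show "\<forall>\<eta> \<epsilon>. admissible \<omega> \<eta> \<epsilon> \<longrightarrow>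
       has_bochner_integral lborel (\<lambda>y. G_integrand s \<omega> (contour \<eta> \<epsilon> y) * (\<i> * cis \<eta>)) J"
      using J direction_of_admissible has_bochner_integral_contour_iff_line by blast
  next
    fix I assume I: "\<forall>\<eta> \<epsilon>. admissible \<omega> \<eta> \<epsilon> \<longrightarrow>
       has_bochner_integral lborel (\<lambda>y. G_integrand s \<omega> (contour \<eta> \<epsilon> y) * (\<i> * cis \<eta>)) I"
    note adm = admissible_of_direction[OF assms]
    have "has_bochner_integral lborel (line_integrand s \<omega> (cis (- (- Arg c)) / of_real (1 / norm c))) I"
      using I adm has_bochner_integral_contour_iff_line[OF adm] by blast
    \<comment> \<open>\<open>J\<close> is the integral for every direction, so \<open>c\<close> need
      not be recovered from its admissible parameters.\<close>
    then show "I = J"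
      using J[OF direction_of_admissible[OF adm]] has_bochner_integral_eq by blast
  qed
  then show ?thesis using J[OF assms] by simp
qed

section \<open>Principal powers and the pointwise three-term identity\<close>

text \<open>Both sides have the same exponential. Their imaginary parts differ by less than
  \<open>pi / 2 + pi / 2 + pi\<close>, which excludes a nonzero multiple of \<open>2 * pi\<close>;
  \<open>z\<close> itself may lie in the left half-plane.\<close>

lemma Ln_divide_Re_pos:
  assumes "Re a > 0" "Re (a / z) > 0"
  shows "Ln (a / z) = Ln a - Ln z"
proof (rule exp_complex_eqI)
  have nz: "a \<noteq> 0" "z \<noteq> 0" using assms by auto
  have "\<bar>Im (Ln a)\<bar> < pi / 2" "\<bar>Im (Ln (a / z))\<bar> < pi / 2"
    using assms nz Re_Ln_pos_lt[of a] Re_Ln_pos_lt[of "a / z"] by simp_all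
  then show "\<bar>Im (Ln (a / z)) - Im (Ln a - Ln z)\<bar> < 2 * pi"
    using mpi_less_Im_Ln[OF nz(2)] Im_Ln_le_pi[OF nz(2)] by auto
  show "exp (Ln (a / z)) = exp (Ln a - Ln z)"
    using nz by (simp add: exp_diff)
qed

lemma Ln_divide_Re_pos':
  assumes "Re a > 0" "Re z > 0"
  shows "Ln (a / z) = Ln a - Ln z"
proof (rule Ln_unique)
  have nz: "a \<noteq> 0" "z \<noteq> 0" using assms by auto
  have *: "\<bar>Im (Ln a)\<bar> < pi / 2" "\<bar>Im (Ln z)\<bar> < pi / 2"
    using assms nz Re_Ln_pos_lt[of a] Re_Ln_pos_lt[of z] by simp_all
  show "exp (Ln a - Ln z) = a / z"
    using nz by (simp add: exp_diff)
  show "- pi < Im (Ln a - Ln z)" "Im (Ln a - Ln z) \<le> pi"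
    using * by auto
qed

text \<open>With \<open>v = - Complex (-1) y\<close> in the right half-plane,
  \<open>m * (v / c)\<close> is also \<open>v / (c / m)\<close>. The two quotient rules for
  \<open>Ln\<close> expand it without any correction by \<open>2 * pi * \<i>\<close>.\<close>

lemma powr_mult_line:
  assumes "Re c > 0" "Re (c / m) > 0"
  shows "(- (m * (Complex (-1) y / c))) powr p = m powr p * (- (Complex (-1) y / c)) powr p"
proof -
  have nz: "c \<noteq> 0" "m \<noteq> 0" using assms by auto
  define v where "v = - Complex (-1) y"
  have v: "Re v > 0" by (simp add: v_def)
  then have nv: "v \<noteq> 0" by auto
  have "Ln (v / (c / m)) = Ln v - (Ln c - Ln m)"
    using Ln_divide_Re_pos'[OF v assms(2)] Ln_divide_Re_pos[OF assms] by simp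
  then have "Ln (m * (v / c)) = Ln m + Ln (v / c)"
    using Ln_divide_Re_pos'[OF v assms(1)] by (simp add: mult.commute)
  then have "(m * (v / c)) powr p = m powr p * (v / c) powr p"
    using nz nv by (simp add: powr_def exp_add[symmetric] algebra_simps)
  then show ?thesis by (simp add: v_def)
qed

lemma line_integrand_three_term:
  fixes s \<omega> c :: complex
  assumes "direction \<omega> c" "direction (\<omega> + 1) c"
  shows "line_integrand s \<omega> c y = line_integrand s (\<omega> + 1) c y +
    (\<omega> + 1) powr (- s) * line_integrand s (\<omega> / (\<omega> + 1)) (c / (\<omega> + 1)) y"
proof -
  define m where "m = \<omega> + 1"
  have m: "m \<noteq> 0" using direction_nonzero[OF assms(2)] by (simp add: m_def)
  define t where "t = Complex (-1) y / c"
  define x where "x = exp (2 * of_real pi * \<i> * t)"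
  define z where "z = exp (- 2 * of_real pi * \<i> * \<omega> * t)"
  define p where "p = (- t) powr (s - 1)"
  have nz: "x \<noteq> 0" "z \<noteq> 0" by (simp_all add: x_def z_def)
  have "- 2 * of_real pi * \<i> * m * t = - 2 * of_real pi * \<i> * \<omega> * t - 2 * of_real pi * \<i> * t"
    by (simp add: m_def algebra_simps)
  then have zx: "exp (- 2 * of_real pi * \<i> * m * t) = z / x"
    by (simp only: x_def z_def exp_diff)
  have "2 * of_real pi * \<i> * (m * t) = 2 * of_real pi * \<i> * t - (- 2 * of_real pi * \<i> * \<omega> * t)"
    by (simp add: m_def algebra_simps)
  then have xz: "exp (2 * of_real pi * \<i> * (m * t)) = x / z"
    by (simp only: x_def z_def exp_diff)
  \<comment> \<open>Regularity for \<open>m\<close> supplies \<open>z \<noteq> x\<close>; the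
    difference \<open>z - x\<close> occurs in the denominators of both summands on the
    right.\<close>
  have "t \<in> regular_set \<omega>" "t \<in> regular_set m"
    unfolding t_def m_def using assms by (auto intro: line_in_regular_set)
  then have "x \<noteq> 1" "z \<noteq> 1" "z / x \<noteq> 1"
    unfolding regular_set_def mem_Collect_eq zx x_def[symmetric] z_def[symmetric] by blast+
  then have ne: "x \<noteq> 1" "z \<noteq> 1" "z \<noteq> x"
    using nz by auto
  have 1: "line_integrand s \<omega> c y = p / ((x - 1) * (z - 1)) * (\<i> / c)"
    by (simp only: line_integrand_def G_integrand_def p_def x_def z_def t_def)
  have 2: "line_integrand s m c y = p / ((x - 1) * (z / x - 1)) * (\<i> / c)"
    unfolding line_integrand_def G_integrand_def t_def[symmetric] zx x_def[symmetric] p_def ..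
  have mt: "Complex (-1) y / (c / m) = m * t" by (simp add: t_def)
  have "(- (m * t)) powr (s - 1) = m powr (s - 1) * p"
    unfolding t_def p_def using assms by (intro powr_mult_line) (auto simp: direction_def m_def)
  moreover have "exp (- 2 * of_real pi * \<i> * (\<omega> / m) * (m * t)) = z"
    using m by (simp add: z_def mult.assoc)
  ultimately have 3: "line_integrand s (\<omega> / m) (c / m) y =
      m powr (s - 1) * p / ((x / z - 1) * (z - 1)) * (m * (\<i> / c))"
    unfolding line_integrand_def G_integrand_def mt xz by simp
  \<comment> \<open>Scaling \<open>t\<close> by \<open>m\<close> produces
    \<open>m powr (s - 1)\<close> from the power and \<open>m\<close> from the differential; the
    factor \<open>m powr (- s)\<close> cancels both.\<close>
  have "m powr (- s) * (m powr (s - 1) * m) = m powr (- s) * (m powr (s - 1) * m powr 1)"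
    using m by simp
  also have "\<dots> = m powr 0"
    by (simp only: powr_add[symmetric]) simp
  finally have "m powr (- s) * (m powr (s - 1) * m) = 1" using m by simp
  moreover have "m powr (- s) * line_integrand s (\<omega> / m) (c / m) y =
      (m powr (- s) * (m powr (s - 1) * m)) * (p / ((x / z - 1) * (z - 1)) * (\<i> / c))"
    unfolding 3 by (simp only: mult_ac times_divide_eq_left times_divide_eq_right)
  ultimately have 4: "m powr (- s) * line_integrand s (\<omega> / m) (c / m) y =
      p / ((x / z - 1) * (z - 1)) * (\<i> / c)"
    by simp
  have "1 / ((x - 1) * (z - 1)) = 1 / ((x - 1) * (z / x - 1)) + 1 / ((x / z - 1) * (z - 1))"
  proof -
    have a: "1 / ((x - 1) * (z / x - 1)) = x / ((x - 1) * (z - x))"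
      using nz by (simp add: field_simps)
    have b: "1 / ((x / z - 1) * (z - 1)) = - (z / ((z - x) * (z - 1)))"
    proof -
      have "(x / z - 1) * (z - 1) = - ((z - x) * (z - 1)) / z"
        using nz by (simp add: field_simps)
      then show ?thesis by simp
    qed
    have "x - 1 \<noteq> 0" "z - 1 \<noteq> 0" "z - x \<noteq> 0" using ne by auto
    then have "1 / ((x - 1) * (z - 1)) = x / ((x - 1) * (z - x)) - z / ((z - x) * (z - 1))"
      by (simp add: divide_simps) (simp add: algebra_simps)
    then show ?thesis by (simp only: a b add_uminus_conv_diff)
  qed
  then have "p * (1 / ((x - 1) * (z - 1))) * (\<i> / c) =
     p * (1 / ((x - 1) * (z / x - 1)) + 1 / ((x / z - 1) * (z - 1))) * (\<i> / c)"
    by simp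
  then have "line_integrand s \<omega> c y = line_integrand s m c y + m powr (- s) * line_integrand s (\<omega> / m) (c / m) y"
    unfolding 1 2 4 by (simp only: distrib_left distrib_right add_divide_distrib times_divide_eq_right mult_1_right)
  then show ?thesis by (simp add: m_def)
qed

section \<open>A line common to the three integrals\<close>

lemma Re_csqrt_pos:
  assumes "\<omega> \<notin> \<real>\<^sub>\<le>\<^sub>0"
  shows "Re (csqrt \<omega>) > 0"
proof -
  have "Re (csqrt \<omega>) \<noteq> 0"
  proof
    assume "Re (csqrt \<omega>) = 0"
    then have "csqrt \<omega> = \<i> * of_real (Im (csqrt \<omega>))" by (simp add: complex_eq_iff)
    then have "\<omega> = (\<i> * of_real (Im (csqrt \<omega>)))\<^sup>2" by (metis power2_csqrt)
    also have "\<dots> = of_real (- (Im (csqrt \<omega>))\<^sup>2)" by (simp add: power_mult_distrib)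
    finally show False using assms by (metis nonpos_Reals_of_real_iff neg_le_0_iff_le zero_le_power2)
  qed
  then show ?thesis using csqrt_principal[of \<omega>] by auto
qed

lemma Re_inverse_pos: "Re z > 0 \<Longrightarrow> Re (inverse z) > 0"
  by (simp add: inverse_complex.sel sum_power2_gt_zero_iff)

text \<open>For \<open>q = csqrt \<omega>\<close> the three relevant numbers are \<open>q\<close>,
  \<open>q / \<omega> = inverse q\<close> and
  \<open>q / (\<omega> + 1) = inverse (q + inverse q)\<close>. All lie in the right half-plane,
  which is closed under sums and inversion.\<close>

lemma common_direction_exists:
  assumes "\<omega> \<notin> \<real>\<^sub>\<le>\<^sub>0"
  obtains c where "direction \<omega> c" "direction (\<omega> + 1) c" "direction (\<omega> / (\<omega> + 1)) (c / (\<omega> + 1))"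
proof -
  define q where "q = csqrt \<omega>"
  have q2: "q * q = \<omega>" using power2_csqrt[of \<omega>] by (simp add: q_def power2_eq_square)
  have q: "Re q > 0"
    unfolding q_def by (rule Re_csqrt_pos[OF assms])
  have q0: "q \<noteq> 0" using q by auto
  have qw: "q / \<omega> = inverse q" using q0 by (simp add: q2[symmetric] field_simps)
  have sum: "Re (q + inverse q) > 0" using q Re_inverse_pos[OF q] by simp
  have "q / (\<omega> + 1) = inverse (q + inverse q)"
  proof -
    have "q + inverse q = (\<omega> + 1) / q" using q0 by (simp add: q2[symmetric] field_simps)
    then show ?thesis by (simp add: inverse_eq_divide)
  qed
  then have pos: "Re q > 0" "Re (q / \<omega>) > 0" "Re (q / (\<omega> + 1)) > 0"
    using q Re_inverse_pos[OF q] Re_inverse_pos[OF sum] by (simp_all add: qw)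
  define \<mu> where "\<mu> = Min {Re q, Re (q / \<omega>), Re (q / (\<omega> + 1))}"
  have \<mu>: "\<mu> > 0" "\<mu> \<le> Re q" "\<mu> \<le> Re (q / \<omega>)" "\<mu> \<le> Re (q / (\<omega> + 1))"
    using pos by (auto simp: \<mu>_def)
  \<comment> \<open>Scaling by \<open>2 / \<mu>\<close> raises all three real parts to at least
    \<open>2\<close>.\<close>
  define c where "c = of_real (2 / \<mu>) * q"
  have scale: "Re (of_real (2 / \<mu>) * u) > 1" if "\<mu> \<le> Re u" for u
    using that \<mu>(1) by (simp add: field_simps)
  have "Re c > 1" "Re (c / \<omega>) > 1" "Re (c / (\<omega> + 1)) > 1"
    unfolding c_def times_divide_eq_right[symmetric] by (intro scale \<mu>)+
  moreover from this have "\<omega> + 1 \<noteq> 0" "\<omega> \<noteq> 0" by auto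
  \<comment> \<open>The second condition on the third direction thus coincides with the second one
    for \<open>\<omega>\<close>, so three inequalities settle all six.\<close>
  then have "c / (\<omega> + 1) / (\<omega> / (\<omega> + 1)) = c / \<omega>"
    by simp
  ultimately show ?thesis
    by (intro that[of c]) (simp_all only: direction_def)
qed

theorem proposition5p8:
  fixes s \<omega> :: complex
  assumes "\<omega> \<notin> \<real>\<^sub>\<le>\<^sub>0"
  shows "G s \<omega> = G s (\<omega> + 1) + (\<omega> + 1) powr (- s) * G s (\<omega> / (\<omega> + 1))"
proof -
  obtain c where c: "direction \<omega> c" "direction (\<omega> + 1) c"
      "direction (\<omega> / (\<omega> + 1)) (c / (\<omega> + 1))"
    using common_direction_exists[OF assms] .
  \<comment> \<open>The third line is the first one multiplied by \<open>\<omega> + 1\<close>, with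
    the same parameter \<open>y\<close>, so the pointwise identity integrates directly.\<close>
  have "has_bochner_integral lborel (\<lambda>y. line_integrand s (\<omega> + 1) c y +
      (\<omega> + 1) powr (- s) * line_integrand s (\<omega> / (\<omega> + 1)) (c / (\<omega> + 1)) y)
    (G s (\<omega> + 1) + (\<omega> + 1) powr (- s) * G s (\<omega> / (\<omega> + 1)))"
    by (intro has_bochner_integral_add has_bochner_integral_mult_right has_bochner_integral_line_G c)
  then have "has_bochner_integral lborel (line_integrand s \<omega> c)
    (G s (\<omega> + 1) + (\<omega> + 1) powr (- s) * G s (\<omega> / (\<omega> + 1)))"
    unfolding line_integrand_three_term[OF c(1,2), symmetric] .
  with has_bochner_integral_line_G[OF c(1)] show ?thesis
    by (rule has_bochner_integral_eq)
qed

end
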